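(* Let $n$ be a prime number, and let $r,s$ be integers with $0\le s<r$. Then $$\chi(G(n,r,s))\le n^{r-s}.$$
   Context: For integers $n,r,s$, let $\mathcal{R}_n=\{0,1,\ldots,n-1\}$ and let $G(n,r,s)$ be the graph whose vertices are all $r$-element subsets of $\mathcal{R}_n$, two distinct vertices $u,v$ being joined by an edge if and only if $|u\cap v|=s$. The chromatic number $\chi(G)$ of a graph $G$ is the least number of colors needed to color its vertices so that the endpoints of every edge have different colors. *)

theory Defs
  imports "HOL-Computational_Algebra.Primes"
begin

text \<open>A graph is a pair of its vertex set and its edge set, an edge being the two-element
  set of its endpoints.\<close>

type_synonym 'a graph = "'a set \<times> 'a set set"

definition simple_graph :: "'a graph \<Rightarrow> bool" where
  "simple_graph G \<longleftrightarrow> (\<forall>e\<in>snd G. e \<subseteq> fst G \<and> card e = 2)"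

definition proper_coloring :: "'a graph \<Rightarrow> nat \<Rightarrow> ('a \<Rightarrow> nat) \<Rightarrow> bool" where
  "proper_coloring G k c \<longleftrightarrow>
     c ` fst G \<subseteq> {..<k} \<and> (\<forall>u v. {u, v} \<in> snd G \<longrightarrow> c u \<noteq> c v)"

text \<open>Meaningful only if a proper coloring with finitely many colors exists; lemma
  \<open>chromatic_number_attained\<close> below shows that this is so for all finite simple graphs.\<close>

definition chromatic_number :: "'a graph \<Rightarrow> nat" where
  "chromatic_number G = (LEAST k. \<exists>c. proper_coloring G k c)"

definition intersection_graph :: "nat \<Rightarrow> nat \<Rightarrow> nat \<Rightarrow> nat set graph" where
  "intersection_graph n r s =
     (let V = {u. u \<subseteq> {0..<n} \<and> card u = r}
      in (V, {{u, v} | u v. u \<in> V \<and> v \<in> V \<and> u \<noteq> v \<and> card (u \<inter> v) = s}))"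

lemma finite_simple_graph_colorable:
  assumes "finite (fst G)" "simple_graph G"
  shows "\<exists>c. proper_coloring G (card (fst G)) c"
proof -
  obtain c where c: "bij_betw c (fst G) {0..<card (fst G)}"
    using ex_bij_betw_finite_nat[OF assms(1)] by blast
  have "c u \<noteq> c v" if e: "{u, v} \<in> snd G" for u v
  proof -
    have "u \<in> fst G" "v \<in> fst G" "card {u, v} = 2"
      using assms(2) e by (auto simp: simple_graph_def)
    moreover from this have "u \<noteq> v" by auto
    ultimately show ?thesis
      using c by (auto simp: bij_betw_def dest: inj_onD)
  qed
  then have "proper_coloring G (card (fst G)) c"
    using c by (auto simp: proper_coloring_def bij_betw_def)
  then show ?thesis by blast
qed

lemma chromatic_number_attained:
  assumes "finite (fst G)" "simple_graph G"
  shows "\<exists>c. proper_coloring G (chromatic_number G) c"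
  unfolding chromatic_number_def
  using finite_simple_graph_colorable[OF assms]
  by (rule LeastI[where P = "\<lambda>k. \<exists>c. proper_coloring G k c"])

lemma finite_intersection_graph: "finite (fst (intersection_graph n r s))"
  by (simp add: intersection_graph_def Let_def)

lemma simple_intersection_graph: "simple_graph (intersection_graph n r s)"
  by (auto simp: intersection_graph_def simple_graph_def Let_def card_2_iff)

end

theory Submission
  imports Defs "HOL-Computational_Algebra.Polynomial" "HOL-Library.FuncSet"
begin

text \<open>To an \<open>r\<close>-subset \<open>u\<close> of \<open>{0..<n}\<close> associate the monic polynomial
  \<open>\<Prod>a\<in>u. (X - a)\<close> of degree \<open>r\<close>, regarded modulo the prime \<open>n\<close>, and color \<open>u\<close> by its
  coefficients at \<open>X\<^sup>s, \<dots>, X\<^sup>r\<^sup>-\<^sup>1\<close>. There are \<open>n ^ (r - s)\<close> such colors. If \<open>u\<close> and \<open>v\<close>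
  receive the same color and meet in \<open>s\<close> points, then the difference of their polynomials has degree
  less than \<open>s\<close> modulo \<open>n\<close>, yet vanishes at the \<open>s\<close> common points. Modulo a prime this forces
  it to be zero (\<open>dvd_coeff_if_many_roots\<close>), and since the polynomial of a set
  determines the set as its roots modulo \<open>n\<close> (\<open>dvd_root_poly_iff\<close>), it follows that \<open>u = v\<close>.
  Hence adjacent sets have different colors.

  The polynomials are kept over the integers, and being zero modulo \<open>n\<close> is expressed by divisibility
  of all coefficients.\<close>

text \<open>Any finite set may serve as the palette, so that colors need not be encoded as numbers.\<close>

lemma chromatic_number_le_card:
  assumes "finite C" and "c ` fst G \<subseteq> C"
    and proper: "\<And>u v. {u, v} \<in> snd G \<Longrightarrow> c u \<noteq> c v"
    and "simple_graph G"
  shows "chromatic_number G \<le> card C"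
proof -
  obtain h where h: "bij_betw h C {0..<card C}"
    using ex_bij_betw_finite_nat[OF \<open>finite C\<close>] by blast
  have "h (c u) \<noteq> h (c v)" if e: "{u, v} \<in> snd G" for u v
  proof -
    have "{u, v} \<subseteq> fst G"
      using assms(4) e by (auto simp only: simple_graph_def)
    then have "c u \<in> C" "c v \<in> C"
      using assms(2) by auto
    with proper[OF e] show ?thesis
      using h by (auto simp: bij_betw_def dest: inj_onD)
  qed
  moreover have "(h \<circ> c) ` fst G \<subseteq> {..<card C}"
    using bij_betwE[OF h] assms(2) by fastforce
  ultimately have "proper_coloring G (card C) (h \<circ> c)"
    by (simp add: proper_coloring_def)
  then show ?thesis
    unfolding chromatic_number_def by (intro Least_le) blast
qed

text \<open>Modulo a prime element \<open>p\<close>, a nonzero polynomial has no more roots than its degree. The bound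
  on the degree modulo \<open>p\<close> is the last hypothesis: the true degree may be larger. The induction
  splits off a linear factor for each root; the quotient vanishes at the other roots because
  \<open>p\<close> is prime.\<close>

lemma dvd_coeff_if_many_roots:
  fixes p :: "'a::idom" and f :: "'a poly"
  assumes "prime_elem p" and "finite A"
    and "\<And>a b. a \<in> A \<Longrightarrow> b \<in> A \<Longrightarrow> p dvd a - b \<Longrightarrow> a = b"
    and "\<And>a. a \<in> A \<Longrightarrow> p dvd poly f a"
    and "\<And>i. card A \<le> i \<Longrightarrow> p dvd coeff f i"
  shows "p dvd coeff f i"
  using assms(2-)
proof (induction A arbitrary: f i rule: finite_induct)
  case empty
  then show ?case by simp
next
  case (insert a A)
  define g where "g = synthetic_div f a"
  have f: "f = [:- a, 1:] * g + [:poly f a:]"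
    unfolding g_def by (rule synthetic_div_correct'[symmetric])
  have coeff_f: "coeff f (Suc k) = coeff g k - a * coeff g (Suc k)" for k
    using arg_cong[OF f, of "\<lambda>h. coeff h (Suc k)"] by simp
  \<comment> \<open>The coefficients of the quotient are determined from the top down.\<close>
  have high: "p dvd coeff g k" if "card A \<le> k" for k
    using that
  proof (induction "Suc (degree g) - k" arbitrary: k)
    case 0
    then show ?case by (simp add: coeff_eq_0)
  next
    case (Suc m)
    have "p dvd coeff g (Suc k)"
      using Suc by simp
    moreover have "p dvd coeff f (Suc k)"
      using insert.prems(3)[of "Suc k"] insert.hyps Suc.prems by simp
    moreover have "coeff g k = coeff f (Suc k) + a * coeff g (Suc k)"
      by (simp add: coeff_f)
    ultimately show ?case by simp
  qed
  have root: "p dvd poly g b" if "b \<in> A" for b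
  proof -
    have "poly f b = (b - a) * poly g b + poly f a"
      using arg_cong[OF f, of "\<lambda>h. poly h b"] by (simp add: algebra_simps)
    moreover have "p dvd poly f b" "p dvd poly f a"
      using insert.prems(2) that by auto
    ultimately have "p dvd (b - a) * poly g b"
      by (simp add: dvd_add_left_iff)
    moreover have "\<not> p dvd b - a"
      using insert.prems(1)[of b a] insert.hyps that by auto
    ultimately show ?thesis
      using assms(1) by (simp add: prime_elem_dvd_mult_iff)
  qed
  have g: "p dvd coeff g k" for k
    using insert.IH[of g k] insert.prems(1) root high by blast
  show ?case
  proof (cases i)
    case 0
    have "coeff f 0 = - a * coeff g 0 + poly f a"
      using arg_cong[OF f, of "\<lambda>h. coeff h 0"] by simp
    then show ?thesis using 0 g insert.prems(2) by simp
  next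
    case (Suc k)
    then show ?thesis using g coeff_f by simp
  qed
qed

lemma dvd_poly_if_dvd_coeff:
  fixes p :: "'a::comm_semiring_1"
  assumes "\<And>i. p dvd coeff f i"
  shows "p dvd poly f x"
  unfolding poly_altdef using assms by (intro dvd_sum dvd_mult2) auto

definition root_poly :: "nat set \<Rightarrow> int poly" where
  "root_poly u = (\<Prod>a\<in>u. [:- int a, 1:])"

lemma degree_root_poly: "degree (root_poly u) = card u"
  unfolding root_poly_def by (subst degree_prod_eq_sum_degree) auto

lemma monic_root_poly: "coeff (root_poly u) (card u) = 1"
  using lead_coeff_prod[of "\<lambda>a. [:- int a, 1:]" u]
  by (simp add: root_poly_def[symmetric] degree_root_poly)

lemma int_eq_if_dvd_diff:
  assumes "a < n" "b < n" "int n dvd int a - int b"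
  shows "a = b"
  using assms mod_eq_dvd_iff[of "int a" "int n" "int b"] by simp

lemma dvd_root_poly_iff:
  assumes "prime n" "u \<subseteq> {0..<n}" "b < n"
  shows "int n dvd poly (root_poly u) (int b) \<longleftrightarrow> b \<in> u"
proof -
  have "finite u" using assms(2) finite_subset by blast
  moreover have "prime_elem (int n)" using assms(1) by simp
  ultimately have "int n dvd poly (root_poly u) (int b) \<longleftrightarrow> (\<exists>a\<in>u. int n dvd int b - int a)"
    by (simp add: root_poly_def poly_prod prime_elem_imp_nonzero prime_dvd_prod_iff assms(1))
  also have "\<dots> \<longleftrightarrow> b \<in> u"
  proof
    assume "\<exists>a\<in>u. int n dvd int b - int a"
    then obtain a where "a \<in> u" "int n dvd int b - int a" by blast
    moreover have "a < n" using \<open>a \<in> u\<close> assms(2) by auto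
    ultimately show "b \<in> u" using int_eq_if_dvd_diff assms(3) by blast
  qed (auto intro: bexI[of _ b])
  finally show ?thesis .
qed

text \<open>The leading terms of the two monic polynomials cancel, so modulo \<open>n\<close> their difference has
  degree less than \<open>card (u \<inter> v)\<close>, while all elements of \<open>u \<inter> v\<close> are roots of it.\<close>

lemma eq_if_upper_coeffs_cong:
  assumes "prime n" and u: "u \<subseteq> {0..<n}" and v: "v \<subseteq> {0..<n}" and "card u = card v"
    and cong: "\<And>i. card (u \<inter> v) \<le> i \<Longrightarrow> i < card u \<Longrightarrow>
      coeff (root_poly u) i mod int n = coeff (root_poly v) i mod int n"
  shows "u = v"
proof -
  define f where "f = root_poly u - root_poly v"
  have fin: "finite u" "finite v" using u v finite_subset by blast+
  have "int n dvd coeff f i" for i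
  proof (rule dvd_coeff_if_many_roots[where A = "int ` (u \<inter> v)"])
    show "prime_elem (int n)" using assms(1) by simp
    show "finite (int ` (u \<inter> v))" using fin by simp
    show "a = b"
      if ab: "a \<in> int ` (u \<inter> v)" "b \<in> int ` (u \<inter> v)" and "int n dvd a - b" for a b
    proof -
      obtain a' b' where "a = int a'" "b = int b'" "a' \<in> u" "b' \<in> u"
        using ab by auto
      moreover have "a' < n" "b' < n"
        using \<open>a' \<in> u\<close> \<open>b' \<in> u\<close> u by auto
      ultimately show ?thesis using int_eq_if_dvd_diff \<open>int n dvd a - b\<close> by simp
    qed
    show "int n dvd poly f a" if a: "a \<in> int ` (u \<inter> v)" for a
    proof -
      obtain b where b: "a = int b" "b \<in> u" "b \<in> v"
        using a by auto
      moreover have "b < n"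
        using \<open>b \<in> u\<close> u by auto
      ultimately show ?thesis
        using dvd_root_poly_iff assms(1) u v by (simp add: f_def dvd_diff)
    qed
    show "int n dvd coeff f i" if "card (int ` (u \<inter> v)) \<le> i" for i
    proof -
      have i: "card (u \<inter> v) \<le> i" using that by (simp add: card_image)
      consider "i < card u" | "i = card u" | "i > card u" by linarith
      then show ?thesis
      proof cases
        case 1
        then show ?thesis using cong[OF i] by (simp add: f_def mod_eq_dvd_iff)
      next
        case 2
        then show ?thesis
          using monic_root_poly[of u] monic_root_poly[of v] assms(4) by (simp add: f_def)
      next
        case 3
        then show ?thesis using assms(4) by (simp add: f_def coeff_eq_0 degree_root_poly)
      qed
    qed
  qed
  then have "poly (root_poly u) x mod int n = poly (root_poly v) x mod int n" for x
    using dvd_poly_if_dvd_coeff[of "int n" f x] by (simp add: f_def mod_eq_dvd_iff)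
  then have "int n dvd poly (root_poly u) x \<longleftrightarrow> int n dvd poly (root_poly v) x" for x
    by (simp add: dvd_eq_mod_eq_0)
  then have "b \<in> u \<longleftrightarrow> b \<in> v" if "b < n" for b
    using dvd_root_poly_iff[OF assms(1)] u v that by blast
  then show ?thesis using u v by (auto simp: subset_iff)
qed

theorem theorem3:
  fixes n r s :: nat
  assumes "prime n" and "s < r"
  shows "chromatic_number (intersection_graph n r s) \<le> n ^ (r - s)"
proof -
  define c where "c u = (\<lambda>i\<in>{s..<r}. coeff (root_poly u) i mod int n)" for u
  define C where "C = ({s..<r} \<rightarrow>\<^sub>E {0..<int n})"
  have "n > 0" using assms(1) by (rule prime_gt_0_nat)
  have "chromatic_number (intersection_graph n r s) \<le> card C"
  proof (rule chromatic_number_le_card)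
    show "finite C" by (simp add: C_def finite_PiE)
    show "c ` fst (intersection_graph n r s) \<subseteq> C"
      using \<open>n > 0\<close> by (auto simp: c_def C_def)
    show "simple_graph (intersection_graph n r s)" by (rule simple_intersection_graph)
    show "c u \<noteq> c v" if e: "{u, v} \<in> snd (intersection_graph n r s)" for u v
    proof
      assume same: "c u = c v"
      have uv: "u \<subseteq> {0..<n}" "v \<subseteq> {0..<n}" "card u = r" "card v = r" "u \<noteq> v" "card (u \<inter> v) = s"
        using e by (auto simp: intersection_graph_def Let_def doubleton_eq_iff Int_commute)
      have "coeff (root_poly u) i mod int n = coeff (root_poly v) i mod int n"
        if "s \<le> i" "i < r" for i
        using fun_cong[OF same, of i] that by (simp add: c_def)
      then show False
        using eq_if_upper_coeffs_cong[OF assms(1), of u v] uv by simp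
    qed
  qed
  also have "card C = n ^ (r - s)" by (simp add: C_def card_PiE)
  finally show ?thesis .
qed

end
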